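(* For any isolate-free graph $G$, there exists a graph $H$ with a total coalition partition $\pi$ of $H$ such that $G$ is isomorphic to the total coalition graph $TCG(H,\pi)$.
   Context: All graphs are finite and simple (no loops or multiple edges). A graph is isolate-free if it has no vertex of degree $0$. A set $T\subseteq V$ of vertices of a graph with vertex set $V$ is a total dominating set if every vertex of $V$ is adjacent to at least one vertex of $T$. Two disjoint sets $A,B\subset V$ form a total coalition if neither $A$ nor $B$ is a total dominating set, but $A\cup B$ is. A total coalition partition of a graph is a partition $\Psi=\{C_1,\dots,C_k\}$ of its vertex set into non-empty classes such that for every $i$ there exists $j\neq i$ such that $C_i$ and $C_j$ form a total coalition. Given a graph $H$ and a total coalition partition $\pi$ of $H$ (not necessarily of maximum cardinality), the total coalition graph $TCG(H,\pi)$ has the classes of $\pi$ as vertices, two classes being adjacent if and only if they form a total coalition in $H$. *)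

theory Defs
  imports "HOL-Library.Disjoint_Sets" "Graph_Theory.Graph_Theory"
begin

text \<open>
  A finite simple graph is a \<^locale>\<open>pair_graph\<close>: a finite loop-free symmetric digraph in which
  an undirected edge \<open>uv\<close> is represented by the two arcs \<open>(u, v)\<close> and \<open>(v, u)\<close>.
  Consequently the degree of a vertex is its out-degree. The null graph is allowed.
\<close>

definition isolate_free :: "'a pair_pre_digraph \<Rightarrow> bool" where
  "isolate_free G \<longleftrightarrow> (\<forall>v \<in> pverts G. out_degree (with_proj G) v \<noteq> 0)"

definition total_dominating_set :: "'a pair_pre_digraph \<Rightarrow> 'a set \<Rightarrow> bool" where
  "total_dominating_set G T \<longleftrightarrow> T \<subseteq> pverts G \<and> (\<forall>v \<in> pverts G. \<exists>t \<in> T. (v, t) \<in> parcs G)"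

definition total_coalition :: "'a pair_pre_digraph \<Rightarrow> 'a set \<Rightarrow> 'a set \<Rightarrow> bool" where
  "total_coalition G A B \<longleftrightarrow> A \<subseteq> pverts G \<and> B \<subseteq> pverts G \<and> A \<inter> B = {} \<and>
     \<not> total_dominating_set G A \<and> \<not> total_dominating_set G B \<and> total_dominating_set G (A \<union> B)"

definition total_coalition_partition :: "'a pair_pre_digraph \<Rightarrow> 'a set set \<Rightarrow> bool" where
  "total_coalition_partition G \<Psi> \<longleftrightarrow> partition_on (pverts G) \<Psi> \<and>
     (\<forall>A \<in> \<Psi>. \<exists>B \<in> \<Psi>. B \<noteq> A \<and> total_coalition G A B)"

definition TCG :: "'a pair_pre_digraph \<Rightarrow> 'a set set \<Rightarrow> 'a set pair_pre_digraph" where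
  "TCG H \<pi> = \<lparr> pverts = \<pi>, parcs = {(A, B). A \<in> \<pi> \<and> B \<in> \<pi> \<and> A \<noteq> B \<and> total_coalition H A B} \<rparr>"

lemma pair_graph_TCG:
  assumes "pair_graph H" "total_coalition_partition H \<pi>"
  shows "pair_graph (TCG H \<pi>)"
proof -
  interpret pair_graph H by fact
  have "\<pi> \<subseteq> Pow (pverts H)"
    using assms(2) by (auto simp: total_coalition_partition_def partition_on_def)
  then have fin: "finite \<pi>"
    by (rule finite_subset) (simp add: pair_finite_verts)
  have "parcs (TCG H \<pi>) \<subseteq> \<pi> \<times> \<pi>"
    by (auto simp: TCG_def)
  then have "finite (parcs (TCG H \<pi>))"
    by (rule finite_subset) (simp add: fin)
  moreover have "sym (parcs (TCG H \<pi>))"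
    by (auto simp: TCG_def total_coalition_def sym_def Un_commute)
  ultimately show ?thesis
    using fin by unfold_locales (auto simp: TCG_def symmetric_def)
qed

end

theory Submission
  imports Defs
begin

text \<open>
  Realise each vertex \<open>v\<close> of \<open>G\<close> by a class \<open>C\<^sub>v\<close> of \<open>H\<close>. Each vertex of \<open>H\<close> has a set
  of missed classes, namely those containing none of its neighbours. Then \<open>C\<^sub>u \<union> C\<^sub>v\<close> is a total
  dominating set iff no vertex of \<open>H\<close> misses both \<open>C\<^sub>u\<close> and \<open>C\<^sub>v\<close>. Hence it suffices that every
  missed set is independent in \<open>G\<close> and that every set \<open>S = {s, t}\<close> with \<open>s\<close>, \<open>t\<close> non-adjacent
  (possibly equal) is missed by some vertex. Take a clique of hubs, one in each class, and
  for every such \<open>S\<close> a vertex in \<open>C\<^sub>s\<close> joined exactly to the hubs of the classes outside \<open>S\<close>.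
\<close>

text \<open>\<open>digraph_iso\<close> asks for a record that also maps arcs, heads and tails. Since
  arcs here are pairs of vertices, \<open>f\<close> determines all of these, and its injectivity
  carries over to arcs.\<close>

lemma digraph_iso_with_projI:
  assumes "pair_wf_digraph G"
    and inj: "inj_on f (pverts G)"
    and verts: "pverts H = f ` pverts G"
    and arcs: "parcs H = map_prod f f ` parcs G"
  shows "digraph_iso (with_proj G) (with_proj H)"
proof -
  interpret pair_wf_digraph G by fact
  let ?h = "\<lparr>iso_verts = f, iso_arcs = map_prod f f, iso_head = snd, iso_tail = fst\<rparr>"
  have "parcs G \<subseteq> pverts G \<times> pverts G"
    using arc_fst_in_verts arc_snd_in_verts by fastforce
  then have "inj_on (map_prod f f) (parcs G)"
    using map_prod_inj_on[OF inj inj] inj_on_subset by blast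
  then have "digraph_isomorphism ?h"
    using inj by (simp add: digraph_isomorphism_def wf_digraph_axioms)
  moreover have "with_proj H = app_iso ?h (with_proj G)"
    by (simp add: app_iso_def with_proj_def verts arcs)
  ultimately show ?thesis
    unfolding digraph_iso_def by blast
qed

lemma isolate_free_neighbour:
  assumes "isolate_free G" "v \<in> pverts G"
  obtains w where "(v, w) \<in> parcs G"
proof -
  have "out_arcs (with_proj G) v \<noteq> {}"
    using assms by (force simp: isolate_free_def out_degree_def)
  then show ?thesis
    using that by (auto simp: out_arcs_def)
qed

text \<open>
  A vertex of \<open>H\<close> is labelled by the vertex of \<open>G\<close> naming its class and the set \<open>S\<close> of the
  header, with \<open>S = {}\<close> marking the hubs.
\<close>

definition labels :: "'a pair_pre_digraph \<Rightarrow> ('a \<times> 'a set) set" where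
  "labels G = {(x, S). x \<in> pverts G \<and>
     (S = {} \<or> (\<exists>t \<in> pverts G. S = {x, t} \<and> (x, t) \<notin> parcs G))}"

text \<open>As hubs carry the empty set, one formula makes any two distinct hubs adjacent and joins
  a hub to the non-hubs whose set avoids it; two non-hubs are never adjacent.\<close>

fun label_adj :: "'a \<times> 'a set \<Rightarrow> 'a \<times> 'a set \<Rightarrow> bool" where
  "label_adj (x, S) (y, T) \<longleftrightarrow> (x, S) \<noteq> (y, T) \<and> (S = {} \<and> x \<notin> T \<or> T = {} \<and> y \<notin> S)"

lemma label_adj_sym: "label_adj p q \<Longrightarrow> label_adj q p"
  by (cases p; cases q) auto

lemma label_adj_irrefl: "\<not> label_adj p p"
  by (cases p) auto

lemma finite_labels:
  assumes "finite (pverts G)"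
  shows "finite (labels G)"
  by (rule finite_subset[of _ "pverts G \<times> Pow (pverts G)"]) (auto simp: labels_def assms)

lemma hub_in_labels: "v \<in> pverts G \<Longrightarrow> (v, {}) \<in> labels G"
  by (simp add: labels_def)

text \<open>If \<open>u\<close> and \<open>v\<close> are non-adjacent, possibly equal, then
  \<open>(u, {u, v})\<close> has no neighbour in either class. If they are adjacent, their two hubs
  suffice: a hub differs from one of them, and the set of a non-hub cannot contain both ends of an
  edge.\<close>

lemma labels_dominated_by_classes_iff:
  assumes "pair_graph G" and "u \<in> pverts G" "v \<in> pverts G"
  shows "(\<forall>p \<in> labels G. \<exists>q \<in> labels G. fst q \<in> {u, v} \<and> label_adj p q) \<longleftrightarrow> (u, v) \<in> parcs G"
    (is "?dom \<longleftrightarrow> _")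
proof
  assume ?dom
  show "(u, v) \<in> parcs G"
  proof (rule ccontr)
    assume "(u, v) \<notin> parcs G"
    then have "(u, {u, v}) \<in> labels G"
      using assms by (auto simp: labels_def)
    then show False
      using \<open>?dom\<close> by fastforce
  qed
next
  interpret pair_graph G by fact
  assume uv: "(u, v) \<in> parcs G"
  then have vu: "(v, u) \<in> parcs G"
    using pair_sym_arcs by (auto simp: symmetric_def elim: symE)
  have ne: "u \<noteq> v"
    using pair_no_loops[OF uv] by simp
  show ?dom
  proof
    fix p assume p: "p \<in> labels G"
    obtain x S where [simp]: "p = (x, S)" by fastforce
    have "label_adj p (u, {}) \<or> label_adj p (v, {})"
    proof (cases "S = {}")
      case True
      then show ?thesis using ne by auto
    next
      case False
      then have "\<not> (u \<in> S \<and> v \<in> S)"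
        using p uv vu ne by (auto simp: labels_def)
      then show ?thesis using False by auto
    qed
    then show "\<exists>q \<in> labels G. fst q \<in> {u, v} \<and> label_adj p q"
      using hub_in_labels[OF assms(2)] hub_in_labels[OF assms(3)]
      by (metis fst_conv insertCI)
  qed
qed

theorem lemma2p5:
  fixes G :: "'a pair_pre_digraph"
  assumes "pair_graph G" and "isolate_free G"
  shows "\<exists>(H :: nat pair_pre_digraph) \<pi>. pair_graph H \<and> total_coalition_partition H \<pi> \<and>
           digraph_iso (with_proj G) (with_proj (TCG H \<pi>))"
proof -
  interpret G: pair_graph G by fact
  have loop: "(x, x) \<notin> parcs G" for x
    using G.pair_no_loops by fastforce
  \<comment> \<open>The vertices of \<open>H\<close> must be naturals, so \<open>d\<close> numbers
    the labels; class and adjacency are read off \<open>d i\<close>.\<close>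
  obtain d and n :: nat where img: "d ` {0..<n} = labels G"
    using ex_bij_betw_nat_finite[OF finite_labels] G.pair_finite_verts bij_betw_imp_surj_on by metis
  define H where "H = \<lparr>pverts = {0..<n},
    parcs = {(i, j). i \<in> {0..<n} \<and> j \<in> {0..<n} \<and> label_adj (d i) (d j)}\<rparr>"
  define C where "C v = {i \<in> {0..<n}. fst (d i) = v}" for v
  define \<pi> where "\<pi> = C ` pverts G"
  have H_simps: "pverts H = {0..<n}"
    "(i, j) \<in> parcs H \<longleftrightarrow> i \<in> {0..<n} \<and> j \<in> {0..<n} \<and> label_adj (d i) (d j)" for i j
    by (auto simp: H_def)
  have finH: "finite (parcs H)"
    by (rule finite_subset[of _ "{0..<n} \<times> {0..<n}"]) (auto simp: H_def)
  have graphH: "pair_graph H"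
    by unfold_locales
      (auto simp: H_simps finH symmetric_def sym_def label_adj_irrefl intro: label_adj_sym)
  have C_subset: "C v \<subseteq> pverts H" for v
    by (auto simp: C_def H_simps)
  have C_ne: "C v \<noteq> {}" if "v \<in> pverts G" for v
  proof -
    from hub_in_labels[OF that] obtain i where "i \<in> {0..<n}" "d i = (v, {})"
      unfolding img[symmetric] by (metis imageE)
    then show ?thesis by (auto simp: C_def)
  qed
  have C_disj: "C u \<inter> C v = {}" if "u \<noteq> v" for u v
    using that by (auto simp: C_def)
  have inj_C: "inj_on C (pverts G)"
    using C_ne C_disj by (metis Int_absorb inj_onI)
  have tds: "total_dominating_set H (C u \<union> C v) \<longleftrightarrow> (u, v) \<in> parcs G"
    if uv: "u \<in> pverts G" "v \<in> pverts G" for u v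
  proof -
    have "total_dominating_set H (C u \<union> C v) \<longleftrightarrow>
      (\<forall>i \<in> {0..<n}. \<exists>j \<in> {0..<n}. fst (d j) \<in> {u, v} \<and> label_adj (d i) (d j))"
      unfolding total_dominating_set_def H_simps C_def by blast
    also have "\<dots> \<longleftrightarrow> (\<forall>p \<in> labels G. \<exists>q \<in> labels G. fst q \<in> {u, v} \<and> label_adj p q)"
      unfolding img[symmetric] by simp
    finally show ?thesis
      using labels_dominated_by_classes_iff[OF assms(1) uv] by simp
  qed
  \<comment> \<open>That no class dominates alone is \<open>tds\<close> on the diagonal, as
    \<open>G\<close> has no loops.\<close>
  have coalition: "total_coalition H (C u) (C v) \<longleftrightarrow> (u, v) \<in> parcs G"
    if uv: "u \<in> pverts G" "v \<in> pverts G" for u v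
    using tds[OF uv] tds[OF uv(1) uv(1)] tds[OF uv(2) uv(2)] loop C_subset C_disj[of u v]
    by (auto simp: total_coalition_def)
  have "partition_on (pverts H) \<pi>"
  proof (rule partition_onI)
    have "d i \<in> labels G" if "i \<in> {0..<n}" for i
      using that img by blast
    then have "fst (d i) \<in> pverts G" if "i \<in> {0..<n}" for i
      using that by (fastforce simp: labels_def)
    then show "\<Union> \<pi> = pverts H"
      by (auto simp: \<pi>_def C_def H_simps)
  next
    show "disjnt p q" if "p \<in> \<pi>" "q \<in> \<pi>" "p \<noteq> q" for p q
      using that C_disj unfolding \<pi>_def disjnt_def by (metis imageE)
  next
    show "{} \<notin> \<pi>"
      using C_ne by (force simp: \<pi>_def)
  qed
  moreover have "\<exists>B \<in> \<pi>. B \<noteq> A \<and> total_coalition H A B" if A: "A \<in> \<pi>" for A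
  proof -
    obtain u where u: "u \<in> pverts G" "A = C u"
      using A by (auto simp: \<pi>_def)
    \<comment> \<open>Isolate-freeness supplies the coalition partner \<open>C v\<close>.\<close>
    obtain v where uv: "(u, v) \<in> parcs G"
      using isolate_free_neighbour[OF assms(2) u(1)] .
    have v: "v \<in> pverts G"
      using G.arc_snd_in_verts[OF uv] by simp
    have "C v \<noteq> A"
      using inj_onD[OF inj_C] u v uv loop by metis
    then show ?thesis
      using coalition[OF u(1) v] uv u v by (auto simp: \<pi>_def)
  qed
  ultimately have part: "total_coalition_partition H \<pi>"
    by (simp add: total_coalition_partition_def)
  have arc_verts: "u \<in> pverts G \<and> v \<in> pverts G" if "(u, v) \<in> parcs G" for u v
    using G.arc_fst_in_verts[OF that] G.arc_snd_in_verts[OF that] by simp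
  have "parcs (TCG H \<pi>) = map_prod C C ` parcs G"
  proof (intro set_eqI iffI)
    fix e assume "e \<in> parcs (TCG H \<pi>)"
    then show "e \<in> map_prod C C ` parcs G"
      using coalition by (force simp: TCG_def \<pi>_def)
  next
    fix e assume "e \<in> map_prod C C ` parcs G"
    then obtain u v where uv: "(u, v) \<in> parcs G" "e = (C u, C v)"
      by auto
    then have "C u \<noteq> C v"
      using inj_onD[OF inj_C] arc_verts loop by metis
    then show "e \<in> parcs (TCG H \<pi>)"
      using uv arc_verts coalition by (auto simp: TCG_def \<pi>_def)
  qed
  then have "digraph_iso (with_proj G) (with_proj (TCG H \<pi>))"
    by (intro digraph_iso_with_projI[where f = C] G.pair_wf_digraph_axioms inj_C)
      (simp_all add: TCG_def \<pi>_def)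
  with graphH part show ?thesis by blast
qed

end
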